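(* Suppose $\Theta$ has the Hahn property on $\mathcal{G}$. Let $\{X^\theta\}_{\theta\in\Theta}$ be any family of functions $X^\theta:\Omega\to\mathbb{R}$ such that for all $\theta,\psi\in\Theta$: (1) $X^\theta$ is $\mathcal{G}^\theta$-measurable, where $\mathcal{G}^\theta$ is the completion of $\mathcal{G}$ under $\theta$; and (2) $X^\theta=X^\psi$ $\theta$-a.s. on $S_{(\theta,\mathcal{G})}\cap S_{(\psi,\mathcal{G})}$. Then there exists a $\mathcal{G}^\Theta$-measurable function $Y$ such that $Y=X^\theta$ $\theta$-a.s. for all $\theta\in\Theta$.
   Context: Setting: $(\Omega,\mathcal{F})$ is a measurable space, $\mathcal{G}\subseteq\mathcal{F}$ a sub-$\sigma$-algebra, $\Theta$ a collection of probability measures on $(\Omega,\mathcal{F})$. $\Theta|_{\mathcal{G}}$ is the set of restrictions $\theta|_{\mathcal{G}}$ of the measures $\theta\in\Theta$ to $\mathcal{G}$. For a $\sigma$-algebra $\mathcal{A}$ and a collection $\Psi$ of probability measures defined on $\mathcal{A}$ (or on a larger $\sigma$-algebra and restricted to $\mathcal{A}$), $\mathcal{A}^\psi$ is the completion of $\mathcal{A}$ under $\psi$, $\mathcal{A}^\Psi=\bigcap_{\psi\in\Psi}\mathcal{A}^\psi$, and $m\mathcal{A}^\Psi$ is the set of $\mathcal{A}^\Psi$-measurable real functions on $\Omega$ (extended-real values are allowed where essential suprema are taken). Each $\psi\in\Psi$ extends uniquely to $\mathcal{A}^\Psi$. A set $N\in\mathcal{A}^\Psi$ is $\Psi$-polar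 if $\psi(N)=0$ for all $\psi\in\Psi$. "Polar" means $\Theta$-polar; a statement holds quasi-surely (q.s.) if it holds except on a polar set. Hahn property: $\Theta$ has the Hahn property on $\mathcal{G}$ if there is a set $\Phi$ (not necessarily countable) of probability measures on $(\Omega,\mathcal{G})$ such that (i) $\Phi$ and $\Theta|_{\mathcal{G}}$ generate the same polar sets and $m\mathcal{G}^\Theta=m\mathcal{G}^\Phi$; (ii) for every $\phi\in\Phi$ there is a set $S_{(\phi,\mathcal{G})}\in\mathcal{G}^\Theta$ with $\phi(S_{(\phi,\mathcal{G})})=1$, and the sets $\{S_{(\phi,\mathcal{G})}\}_{\phi\in\Phi}$ are disjoint. Fix such a $\Phi$ and such sets. $\Theta$-essential supremum: for a family $\mathcal{X}$ of $\mathcal{G}^\Theta$-measurable functions, $\Theta\text{-ess sup}\,\mathcal{X}$ is the q.s. unique $\mathcal{G}^\Theta$-measurable (extended-real) $X^*$ such that $X^*\ge X$ q.s. for all $X\in\mathcal{X}$, and any other such function $Y$ with this property satisfies $Y\ge X^*$ q.s. (Under the Hahn property it exists.) Supports of $\theta\in\Theta$: under the Hahn property, $\theta|_{\mathcal{G}}$ is absolutely continuous with respect to $\phi$ on $S_{(\phi,\mathcal{G})}$ for each $\phi\in\Phi$. Put $\lambda_{\theta|\phi}:=\frac{d\theta|_{\mathcal{G}}}{d\phi}I_{S_{(\phi,\mathcal{G})}}$ (the Radon-Nikodym derivative on $S_{(\phi,\mathcal{G})}$, and $0$ elsewhere; defined up to a polar set), and define the $\mathcal{G}^\Theta$-measurable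 support of $\theta$ by $S_{(\theta,\mathcal{G})}:=\{\omega:\Theta\text{-ess sup}_{\phi\in\Phi}(\lambda_{\theta|\phi})>0\}\in\mathcal{G}^\Theta$, which is defined up to a polar set. As the name "support" indicates, it is understood that $\theta(S_{(\theta,\mathcal{G})})=1$. *)

theory Defs
  imports "HOL-Probability.Probability"
begin

text \<open>A \<sigma>-algebra is represented by a measure, of which only space and sets are used.\<close>

definition completion_on :: "'a measure \<Rightarrow> 'a measure \<Rightarrow> 'a measure" where
  "completion_on A \<psi> = completion (restr_to_subalg \<psi> A)"

text \<open>The intersection with the power set only matters for an empty \<open>\<Psi>\<close>; the sets fed to
  \<open>sigma\<close> already form a \<sigma>-algebra, see \<open>sets_joint_completion\<close> below.\<close>

definition joint_completion :: "'a measure \<Rightarrow> 'a measure set \<Rightarrow> 'a measure" where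
  "joint_completion A \<Psi> =
     sigma (space A) (Pow (space A) \<inter> (\<Inter>\<psi>\<in>\<Psi>. sets (completion_on A \<psi>)))"

lemma space_joint_completion [simp]: "space (joint_completion A \<Psi>) = space A"
  unfolding joint_completion_def by (simp add: space_measure_of_conv)

lemma sets_joint_completion:
  assumes "\<And>\<psi>. \<psi> \<in> \<Psi> \<Longrightarrow> subalgebra \<psi> A"
  shows "sets (joint_completion A \<Psi>) = {B. B \<subseteq> space A \<and> (\<forall>\<psi>\<in>\<Psi>. B \<in> sets (completion_on A \<psi>))}"
proof -
  have sp: "space (completion_on A \<psi>) = space A" if "\<psi> \<in> \<Psi>" for \<psi>
    using assms[OF that] by (simp add: completion_on_def space_restr_to_subalg subalgebra_def)
  let ?C = "Pow (space A) \<inter> (\<Inter>\<psi>\<in>\<Psi>. sets (completion_on A \<psi>))"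
  have "sigma_algebra (space A) ?C"
    unfolding sigma_algebra_iff2
  proof (intro conjI ballI allI impI)
    fix B assume B: "B \<in> ?C"
    have "space A - B \<in> sets (completion_on A \<psi>)" if "\<psi> \<in> \<Psi>" for \<psi>
      using B that sets.compl_sets[of B "completion_on A \<psi>"] sp[OF that] by auto
    then show "space A - B \<in> ?C" by blast
  next
    fix B :: "nat \<Rightarrow> 'a set" assume "range B \<subseteq> ?C"
    then show "\<Union> (range B) \<in> ?C" by (auto intro!: sets.countable_UN)
  qed auto
  then have "sets (joint_completion A \<Psi>) = ?C"
    unfolding joint_completion_def by (rule sigma_algebra.sets_measure_of_eq)
  then show ?thesis by blast
qed

definition extension :: "'a measure \<Rightarrow> 'a measure set \<Rightarrow> 'a measure \<Rightarrow> 'a measure" where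
  "extension A \<Psi> \<psi> = restr_to_subalg (completion_on A \<psi>) (joint_completion A \<Psi>)"

definition polar :: "'a measure \<Rightarrow> 'a measure set \<Rightarrow> 'a set \<Rightarrow> bool" where
  "polar A \<Psi> N \<longleftrightarrow>
     N \<in> sets (joint_completion A \<Psi>) \<and> (\<forall>\<psi>\<in>\<Psi>. emeasure (extension A \<Psi> \<psi>) N = 0)"

definition quasi_surely :: "'a measure \<Rightarrow> 'a measure set \<Rightarrow> ('a \<Rightarrow> bool) \<Rightarrow> bool" where
  "quasi_surely M \<Theta> P \<longleftrightarrow> (\<exists>N. polar M \<Theta> N \<and> (\<forall>\<omega>\<in>space M - N. P \<omega>))"

definition hahn_witness ::
  "'a measure \<Rightarrow> 'a measure set \<Rightarrow> 'a measure set \<Rightarrow> ('a measure \<Rightarrow> 'a set) \<Rightarrow> bool" where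
  "hahn_witness G \<Theta> \<Phi> S \<longleftrightarrow>
     (\<forall>\<phi>\<in>\<Phi>. prob_space \<phi> \<and> sets \<phi> = sets G) \<and>
     (\<forall>N. polar G \<Phi> N \<longleftrightarrow> polar G \<Theta> N) \<and>
     (borel_measurable (joint_completion G \<Theta>) :: ('a \<Rightarrow> real) set) =
       borel_measurable (joint_completion G \<Phi>) \<and>
     (\<forall>\<phi>\<in>\<Phi>. S \<phi> \<in> sets (joint_completion G \<Theta>) \<and> emeasure (extension G \<Phi> \<phi>) (S \<phi>) = 1) \<and>
     disjoint_family_on S \<Phi>"

text \<open>Supports depend on the chosen \<open>\<Phi>\<close> and \<open>S\<close>, so statements about supports
  quantify over arbitrary witnesses instead of assuming \<open>hahn_property\<close>.\<close>

definition hahn_property :: "'a measure \<Rightarrow> 'a measure set \<Rightarrow> bool" where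
  "hahn_property G \<Theta> \<longleftrightarrow> (\<exists>\<Phi> S. hahn_witness G \<Theta> \<Phi> S)"

text \<open>The essential supremum is only unique up to polar sets, hence a predicate
  characterising all its versions.\<close>

definition is_ess_sup ::
  "'a measure \<Rightarrow> 'a measure \<Rightarrow> 'a measure set \<Rightarrow> ('a \<Rightarrow> ereal) set \<Rightarrow> ('a \<Rightarrow> ereal) \<Rightarrow> bool" where
  "is_ess_sup M G \<Theta> \<X> Z \<longleftrightarrow>
     Z \<in> borel_measurable (joint_completion G \<Theta>) \<and>
     (\<forall>X\<in>\<X>. quasi_surely M \<Theta> (\<lambda>\<omega>. X \<omega> \<le> Z \<omega>)) \<and>
     (\<forall>Y\<in>borel_measurable (joint_completion G \<Theta>).
        (\<forall>X\<in>\<X>. quasi_surely M \<Theta> (\<lambda>\<omega>. X \<omega> \<le> Y \<omega>)) \<longrightarrow>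
        quasi_surely M \<Theta> (\<lambda>\<omega>. Z \<omega> \<le> Y \<omega>))"

text \<open>Here \<open>S \<phi>\<close> need not lie in \<open>G\<close>, so the derivative is taken between the extensions of
  \<open>\<theta>\<close> and \<open>\<phi>\<close> to the joint completion, both restricted to \<open>S \<phi>\<close>. The two joint completions
  of \<open>G\<close> (under \<open>\<Theta>\<close> and under \<open>\<Phi>\<close>) coincide by the Hahn property.\<close>

definition support_density ::
  "'a measure \<Rightarrow> 'a measure set \<Rightarrow> 'a measure set \<Rightarrow> ('a measure \<Rightarrow> 'a set)
     \<Rightarrow> 'a measure \<Rightarrow> 'a measure \<Rightarrow> 'a \<Rightarrow> ereal" where
  "support_density G \<Theta> \<Phi> S \<theta> \<phi> \<omega> =
     enn2ereal (RN_deriv (restrict_space (extension G \<Phi> \<phi>) (S \<phi>))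
                         (restrict_space (extension G \<Theta> \<theta>) (S \<phi>)) \<omega>) * indicator (S \<phi>) \<omega>"

text \<open>As \<open>Z\<close> ranges over all versions of the essential supremum, \<open>T\<close> ranges over all versions of
  the support. That \<open>T\<close> has full measure is part of the notion of a support: it does not follow
  from the other conditions if real-valued measurable cardinals exist.\<close>

definition is_support ::
  "'a measure \<Rightarrow> 'a measure \<Rightarrow> 'a measure set \<Rightarrow> 'a measure set \<Rightarrow> ('a measure \<Rightarrow> 'a set)
     \<Rightarrow> 'a measure \<Rightarrow> 'a set \<Rightarrow> bool" where
  "is_support M G \<Theta> \<Phi> S \<theta> T \<longleftrightarrow>
     (\<exists>Z. is_ess_sup M G \<Theta> (support_density G \<Theta> \<Phi> S \<theta> ` \<Phi>) Z \<and> T = {\<omega>\<in>space M. Z \<omega> > 0}) \<and>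
     emeasure (extension G \<Theta> \<theta>) T = 1"

end

theory Submission
  imports Defs
begin

text \<open>
  On a carrier \<open>S \<phi>\<close> of the Hahn witness every \<open>\<theta>\<close> is absolutely continuous with respect to
  \<open>\<phi>\<close>: a \<open>\<phi>\<close>-null subset of \<open>S \<phi>\<close> is null for every other member of \<open>\<Phi>\<close> too, since the carriers
  are disjoint, so it is polar. Conversely, \<open>\<phi>\<close> is absolutely continuous with respect to \<open>\<theta>\<close> on the
  set \<open>support_part \<theta> \<phi>\<close> where the derivative of \<open>\<theta>\<close> by \<open>\<phi>\<close> is positive. Hence on these sets
  \<open>\<theta>\<close> and \<open>\<phi>\<close> have the same null sets.

  Each \<open>X \<theta>\<close> equals, outside a \<open>\<theta>\<close>-null set of \<open>G\<close>, a \<open>G\<close>-measurable function \<open>g \<theta>\<close>. By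
  the equivalence of measures just described, the functions \<open>g \<theta>\<close> and \<open>g \<psi>\<close> agree \<open>\<phi>\<close>-almost
  everywhere on \<open>support_part \<theta> \<phi> \<inter> support_part \<psi> \<phi>\<close>. For a single finite measure \<open>\<phi>\<close>, any family of
  such compatible partial functions can be glued, because countably many of the domains cover all of
  them up to null sets (\<open>ex_countable_essential_cover\<close>, \<open>ex_measurable_gluing\<close>). This gives
  a function \<open>y \<phi>\<close>, and \<open>Y\<close> is \<open>y \<phi>\<close> on \<open>S \<phi>\<close> and \<open>0\<close> off all the carriers.

  However many carriers there are, \<open>Y\<close> is measurable: for every \<open>\<phi>\<close> it equals \<open>y \<phi>\<close> outside a
  \<open>\<phi>\<close>-null set, so it is measurable for the joint completion under \<open>\<Phi>\<close>, which has the same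
  measurable real functions as the one under \<open>\<Theta>\<close>. Finally, \<open>\<theta>\<close> charges only countably many
  carriers (\<open>countable_not_null_S\<close>). The pointwise supremum of the corresponding derivatives is
  therefore a measurable upper bound of all the derivatives, so it dominates their essential
  supremum, and the support of \<open>\<theta>\<close> is covered, up to a null set, by countably many of the sets
  \<open>support_part \<theta> \<phi>\<close> (\<open>AE_in_charged_support_part\<close>). On each of them \<open>Y\<close> agrees with \<open>X \<theta>\<close>
  \<open>\<theta>\<close>-almost surely, and the support has full measure.
\<close>

section \<open>Gluing compatible functions for a finite measure\<close>

text \<open>Any family of measurable sets, however large, has a countable subfamily whose union contains
  every member up to a null set: take one that maximises the measure of the union.\<close>

lemma (in finite_measure) ex_countable_essential_cover:
  fixes D :: "'i \<Rightarrow> 'a set"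
  assumes "I \<noteq> {}" and D: "\<And>i. i \<in> I \<Longrightarrow> D i \<in> sets M"
  obtains \<sigma> :: "nat \<Rightarrow> 'i"
  where "range \<sigma> \<subseteq> I" and "\<And>i. i \<in> I \<Longrightarrow> D i - (\<Union>n. D (\<sigma> n)) \<in> null_sets M"
proof -
  define \<C> where "\<C> = {C. C \<subseteq> I \<and> countable C \<and> C \<noteq> {}}"
  define \<mu> where "\<mu> C = emeasure M (\<Union>i\<in>C. D i)" for C
  have meas: "(\<Union>i\<in>C. D i) \<in> sets M" if "C \<in> \<C>" for C
    using that D by (auto simp: \<C>_def intro!: sets.countable_UN')
  obtain i0 where "i0 \<in> I" using assms(1) by auto
  then have "{i0} \<in> \<C>" by (auto simp: \<C>_def)
  then have "\<C> \<noteq> {}" by auto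
  from ennreal_SUP_countable_SUP[OF this, of \<mu>]
  obtain f :: "nat \<Rightarrow> ennreal" where f: "range f \<subseteq> \<mu> ` \<C>" "Sup (\<mu> ` \<C>) = (SUP n. f n)"
    by auto
  then have "\<forall>n. \<exists>C\<in>\<C>. f n = \<mu> C" by blast
  then obtain c where c: "\<And>n. c n \<in> \<C>" "\<And>n. f n = \<mu> (c n)" by metis
  define C where "C = (\<Union>n. c n)"
  have C: "C \<in> \<C>" using c(1) by (auto simp: C_def \<C>_def)
  have max: "\<mu> B \<le> \<mu> C" if "B \<in> \<C>" for B
  proof -
    have "\<mu> B \<le> (SUP n. f n)" using that f(2) by (metis SUP_upper)
    also have "\<dots> \<le> \<mu> C"
      unfolding c(2) \<mu>_def by (intro SUP_least emeasure_mono meas C) (auto simp: C_def)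
    finally show ?thesis .
  qed
  have null: "D i - (\<Union>j\<in>C. D j) \<in> null_sets M" if i: "i \<in> I" for i
  proof -
    have iC: "insert i C \<in> \<C>" using C i by (auto simp: \<C>_def)
    have "emeasure M ((\<Union>j\<in>insert i C. D j) - (\<Union>j\<in>C. D j)) = \<mu> (insert i C) - \<mu> C"
      unfolding \<mu>_def by (rule emeasure_Diff[OF _ meas[OF iC] meas[OF C]]) auto
    moreover have "(\<Union>j\<in>insert i C. D j) - (\<Union>j\<in>C. D j) = D i - (\<Union>j\<in>C. D j)" by auto
    ultimately have "emeasure M (D i - (\<Union>j\<in>C. D j)) = \<mu> (insert i C) - \<mu> C" by simp
    also have "\<dots> = 0" using max[OF iC] by (simp add: diff_eq_0_iff_ennreal \<mu>_def less_top[symmetric])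
    finally show ?thesis using D[OF i] meas[OF C] by (auto intro: null_setsI)
  qed
  have "range (from_nat_into C) = C" using C by (auto simp: \<C>_def intro!: range_from_nat_into)
  then have "(\<Union>n. D (from_nat_into C n)) = (\<Union>j\<in>C. D j)" by (metis image_image)
  then show thesis
    using that[of "from_nat_into C"] null C \<open>range (from_nat_into C) = C\<close> by (auto simp: \<C>_def)
qed

text \<open>The family may be uncountable, and the exceptional set may depend on the pair of indices.\<close>

lemma (in finite_measure) ex_measurable_gluing:
  fixes g :: "'i \<Rightarrow> 'a \<Rightarrow> real"
  assumes D: "\<And>i. i \<in> I \<Longrightarrow> D i \<in> sets M"
    and g: "\<And>i. i \<in> I \<Longrightarrow> g i \<in> borel_measurable M"
    and agree: "\<And>i j. i \<in> I \<Longrightarrow> j \<in> I \<Longrightarrow> AE \<omega> in M. \<omega> \<in> D i \<inter> D j \<longrightarrow> g i \<omega> = g j \<omega>"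
  shows "\<exists>Y\<in>borel_measurable M. \<forall>i\<in>I. AE \<omega> in M. \<omega> \<in> D i \<longrightarrow> Y \<omega> = g i \<omega>"
proof (cases "I = {}")
  case True
  then show ?thesis by (intro bexI[of _ "\<lambda>_. 0"]) simp_all
next
  case False
  obtain \<sigma> :: "nat \<Rightarrow> 'i" where \<sigma>: "range \<sigma> \<subseteq> I"
    and null: "\<And>i. i \<in> I \<Longrightarrow> D i - (\<Union>n. D (\<sigma> n)) \<in> null_sets M"
    using ex_countable_essential_cover[of I D, OF False D] by blast
  have \<sigma>I: "\<sigma> n \<in> I" for n using \<sigma> by auto
  note [measurable] = D[OF \<sigma>I] g[OF \<sigma>I]
  \<comment> \<open>Off the union of all \<open>D (\<sigma> n)\<close> the index is unspecified; there each \<open>D i\<close> is null.\<close>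
  define k where "k \<omega> = (LEAST n. \<omega> \<in> D (\<sigma> n))" for \<omega>
  have [measurable]: "k \<in> measurable M (count_space UNIV)" unfolding k_def by measurable
  define Y where "Y \<omega> = g (\<sigma> (k \<omega>)) \<omega>" for \<omega>
  have "Y \<in> borel_measurable M"
    unfolding Y_def by (rule measurable_compose_countable[of "\<lambda>n. g (\<sigma> n)"]) measurable
  moreover have "AE \<omega> in M. \<omega> \<in> D i \<longrightarrow> Y \<omega> = g i \<omega>" if i: "i \<in> I" for i
  proof -
    have "AE \<omega> in M. \<forall>n. \<omega> \<in> D i \<inter> D (\<sigma> n) \<longrightarrow> g i \<omega> = g (\<sigma> n) \<omega>"
      using agree[OF i \<sigma>I] by (simp add: AE_all_countable)
    with AE_not_in[OF null[OF i]] show ?thesis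
    proof eventually_elim
      case (elim \<omega>)
      show ?case
      proof
        assume "\<omega> \<in> D i"
        with elim(1) obtain n where "\<omega> \<in> D (\<sigma> n)" by auto
        then have "\<omega> \<in> D (\<sigma> (k \<omega>))" unfolding k_def by (rule LeastI)
        with elim(2) \<open>\<omega> \<in> D i\<close> show "Y \<omega> = g i \<omega>" by (simp add: Y_def)
      qed
    qed
  qed
  ultimately show ?thesis by blast
qed

lemma borel_measurable_completion_cong_AE:
  assumes f: "f \<in> borel_measurable (completion M)" and AE: "AE \<omega> in completion M. f \<omega> = h \<omega>"
  shows "h \<in> borel_measurable (completion M)"
proof (rule measurableI)
  fix B :: "'b set" assume "B \<in> sets borel"
  with f have "f -` B \<inter> space (completion M) \<in> sets (completion M)" by (rule measurable_sets)
  moreover have "AE \<omega> in completion M.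
      \<omega> \<in> f -` B \<inter> space (completion M) \<longleftrightarrow> \<omega> \<in> h -` B \<inter> space (completion M)"
    using AE by eventually_elim simp
  ultimately show "h -` B \<inter> space (completion M) \<in> sets (completion M)"
    by (metis completion.in_sets_AE inf_le2)
qed simp

section \<open>Joint completions of a \<open>\<sigma>\<close>-algebra\<close>

text \<open>A set \<open>\<Psi>\<close> of measures, each defined at least on the \<open>\<sigma>\<close>-algebra \<open>A\<close>.\<close>

locale subalgebra_family =
  fixes A :: "'a measure" and \<Psi> :: "'a measure set"
  assumes subalgebra: "\<And>\<psi>. \<psi> \<in> \<Psi> \<Longrightarrow> subalgebra \<psi> A"
begin

lemma sets_joint: "sets (joint_completion A \<Psi>) =
    {B. B \<subseteq> space A \<and> (\<forall>\<psi>\<in>\<Psi>. B \<in> sets (completion_on A \<psi>))}"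
  by (rule sets_joint_completion[OF subalgebra])

lemma space_completion_on: "\<psi> \<in> \<Psi> \<Longrightarrow> space (completion_on A \<psi>) = space A"
  using subalgebra by (simp add: completion_on_def space_restr_to_subalg subalgebra_def)

lemma subalgebra_joint: "\<psi> \<in> \<Psi> \<Longrightarrow> subalgebra (completion_on A \<psi>) (joint_completion A \<Psi>)"
  by (auto simp: subalgebra_def[of "completion_on A \<psi>"] space_completion_on sets_joint)

lemma sets_extension: "\<psi> \<in> \<Psi> \<Longrightarrow> sets (extension A \<Psi> \<psi>) = sets (joint_completion A \<Psi>)"
  unfolding extension_def by (intro sets_restr_to_subalg subalgebra_joint)

lemma space_extension: "\<psi> \<in> \<Psi> \<Longrightarrow> space (extension A \<Psi> \<psi>) = space A"
  using sets_eq_imp_space_eq[OF sets_extension] by simp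

lemma sets_subset_joint: "sets A \<subseteq> sets (joint_completion A \<Psi>)"
  using sets.sets_into_space[of _ A] subalgebra
  by (auto simp: sets_joint completion_on_def sets_restr_to_subalg)

lemma null_sets_extension_iff:
  assumes "\<psi> \<in> \<Psi>"
  shows "N \<in> null_sets (extension A \<Psi> \<psi>) \<longleftrightarrow>
    N \<in> sets (joint_completion A \<Psi>) \<and> (\<exists>N'\<in>null_sets \<psi> \<inter> sets A. N \<subseteq> N')"
  using null_sets_restr_to_subalg[OF subalgebra_joint[OF assms]]
    null_sets_restr_to_subalg[OF subalgebra[OF assms]]
  by (auto simp: extension_def completion_on_def null_sets_completion_iff2)

lemma prob_space_extension:
  assumes \<psi>: "\<psi> \<in> \<Psi>" and "prob_space \<psi>"
  shows "prob_space (extension A \<Psi> \<psi>)"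
proof -
  have "prob_space (completion_on A \<psi>)"
    unfolding completion_on_def
    using prob_space_restr_to_subalg[OF subalgebra[OF \<psi>] assms(2)]
    by (rule prob_space.prob_space_completion)
  then show ?thesis
    unfolding extension_def by (rule prob_space_restr_to_subalg[OF subalgebra_joint[OF \<psi>]])
qed

lemma AE_if_AE_extension:
  assumes \<psi>: "\<psi> \<in> \<Psi>" and AE: "AE \<omega> in extension A \<Psi> \<psi>. P \<omega>"
  shows "AE \<omega> in \<psi>. P \<omega>"
proof -
  have sp: "space (extension A \<Psi> \<psi>) = space \<psi>"
    using space_extension[OF \<psi>] subalgebra[OF \<psi>] by (simp add: subalgebra_def)
  from AE obtain N where N: "N \<in> null_sets (extension A \<Psi> \<psi>)"
      "{\<omega>\<in>space \<psi>. \<not> P \<omega>} \<subseteq> N"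
    unfolding eventually_ae_filter sp by auto
  then obtain N' where "N' \<in> null_sets \<psi>" "N \<subseteq> N'"
    using null_sets_extension_iff[OF \<psi>] by auto
  with N(2) show ?thesis by (intro AE_I'[of N']) auto
qed

lemma null_sets_extensionI:
  assumes \<psi>: "\<psi> \<in> \<Psi>" and N: "N \<in> sets (joint_completion A \<Psi>)" and AE: "AE \<omega> in \<psi>. \<omega> \<notin> N"
  shows "N \<in> null_sets (extension A \<Psi> \<psi>)"
proof -
  note sub = subalgebra[OF \<psi>]
  have "N \<in> sets (completion (restr_to_subalg \<psi> A))"
    using N \<psi> by (simp add: sets_joint completion_on_def)
  then obtain B E E' where B: "N = B \<union> E" "E \<subseteq> E'" "E' \<in> null_sets (restr_to_subalg \<psi> A)"
      "B \<in> sets (restr_to_subalg \<psi> A)"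
    by (rule sets_completionE)
  have "AE \<omega> in \<psi>. \<omega> \<notin> B" using AE by eventually_elim (use B(1) in auto)
  moreover have "B \<in> sets A" using B(4) by (simp add: sets_restr_to_subalg[OF sub])
  moreover have "B \<in> sets \<psi>" using sub \<open>B \<in> sets A\<close> by (auto simp: subalgebra_def)
  ultimately have "B \<in> null_sets \<psi> \<inter> sets A" by (simp add: AE_iff_null_sets)
  moreover have "E' \<in> null_sets \<psi> \<inter> sets A" using B(3) by (simp add: null_sets_restr_to_subalg[OF sub])
  ultimately have "B \<union> E' \<in> null_sets \<psi> \<inter> sets A" by auto
  with B N show ?thesis
    unfolding null_sets_extension_iff[OF \<psi>] by blast
qed

lemma polar_iff_null_sets:
  "polar A \<Psi> N \<longleftrightarrow>
    N \<in> sets (joint_completion A \<Psi>) \<and> (\<forall>\<psi>\<in>\<Psi>. N \<in> null_sets (extension A \<Psi> \<psi>))"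
  using sets_extension by (auto simp: polar_def null_sets_def)

lemma AE_if_quasi_surely:
  assumes \<psi>: "\<psi> \<in> \<Psi>" and "quasi_surely A \<Psi> P"
  shows "AE \<omega> in \<psi>. P \<omega>"
proof -
  obtain N where N: "polar A \<Psi> N" "\<forall>\<omega>\<in>space A - N. P \<omega>"
    using assms(2) by (auto simp: quasi_surely_def)
  then have "N \<in> null_sets (extension A \<Psi> \<psi>)"
    using \<psi> by (simp add: polar_iff_null_sets)
  then have "AE \<omega> in extension A \<Psi> \<psi>. P \<omega>"
    using N(2) by (intro AE_I'[of N]) (auto simp: space_extension[OF \<psi>])
  then show ?thesis by (rule AE_if_AE_extension[OF \<psi>])
qed

lemma borel_measurable_jointI:
  assumes "\<And>\<psi>. \<psi> \<in> \<Psi> \<Longrightarrow> f \<in> borel_measurable (completion_on A \<psi>)"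
  shows "f \<in> borel_measurable (joint_completion A \<Psi>)"
proof (rule measurableI)
  fix B :: "'b::topological_space set" assume "B \<in> sets borel"
  then show "f -` B \<inter> space (joint_completion A \<Psi>) \<in> sets (joint_completion A \<Psi>)"
    using measurable_sets[OF assms] by (auto simp: sets_joint space_completion_on)
qed simp

end

text \<open>Polarity passes to a larger \<open>\<sigma>\<close>-algebra. Quasi-sure statements refer to \<open>M\<close>, whereas the
  exceptional sets found below belong to the joint completion of \<open>G\<close>.\<close>

lemma polar_mono_algebra:
  assumes sub: "subalgebra A B" and \<Psi>: "\<And>\<psi>. \<psi> \<in> \<Psi> \<Longrightarrow> subalgebra \<psi> A" and polar: "polar B \<Psi> N"
  shows "polar A \<Psi> N"
proof -
  interpret A: subalgebra_family A \<Psi> by unfold_locales (rule \<Psi>)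
  interpret B: subalgebra_family B \<Psi>
    by unfold_locales (metis sub \<Psi> subalgebra_def order_trans)
  have N: "\<exists>N'\<in>null_sets \<psi> \<inter> sets A. N \<subseteq> N'" if "\<psi> \<in> \<Psi>" for \<psi>
  proof -
    have "\<exists>N'\<in>null_sets \<psi> \<inter> sets B. N \<subseteq> N'"
      using polar that by (simp add: B.polar_iff_null_sets B.null_sets_extension_iff)
    then show ?thesis using sub unfolding subalgebra_def by blast
  qed
  have "N \<subseteq> space A"
    using sub polar by (auto simp: polar_def B.sets_joint subalgebra_def)
  moreover have "N \<in> sets (completion_on A \<psi>)" if "\<psi> \<in> \<Psi>" for \<psi>
    using N[OF that] null_sets_restr_to_subalg[OF \<Psi>[OF that]] unfolding completion_on_def
    by (metis null_sets_completion)
  ultimately have "N \<in> sets (joint_completion A \<Psi>)" by (simp add: A.sets_joint)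
  with N show ?thesis by (simp add: A.polar_iff_null_sets A.null_sets_extension_iff)
qed

section \<open>Measures with the Hahn property\<close>

text \<open>A set \<open>\<Theta>\<close> of probability measures on \<open>M\<close> with a witness of its Hahn property on \<open>G\<close>.\<close>

locale hahn_setting =
  fixes M G :: "'a measure" and \<Theta> \<Phi> :: "'a measure set" and S :: "'a measure \<Rightarrow> 'a set"
  assumes subalgebra_G: "subalgebra M G"
    and prob_\<Theta>: "\<And>\<theta>. \<theta> \<in> \<Theta> \<Longrightarrow> prob_space \<theta> \<and> sets \<theta> = sets M"
    and witness: "hahn_witness G \<Theta> \<Phi> S"
begin

abbreviation J :: "'a measure" where "J \<equiv> joint_completion G \<Theta>"

abbreviation \<Theta>_ext :: "'a measure \<Rightarrow> 'a measure" where "\<Theta>_ext \<equiv> extension G \<Theta>"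

abbreviation \<Phi>_ext :: "'a measure \<Rightarrow> 'a measure" where "\<Phi>_ext \<equiv> extension G \<Phi>"

abbreviation derivative :: "'a measure \<Rightarrow> 'a measure \<Rightarrow> 'a \<Rightarrow> ereal" where
  "derivative \<equiv> support_density G \<Theta> \<Phi> S"

text \<open>The part of the support of \<open>\<theta>\<close> that lies in \<open>S \<phi>\<close>, for the version of the
  Radon--Nikodym derivative chosen by \<open>support_density\<close>.\<close>

definition support_part :: "'a measure \<Rightarrow> 'a measure \<Rightarrow> 'a set" where
  "support_part \<theta> \<phi> = {\<omega>\<in>space G. derivative \<theta> \<phi> \<omega> > 0}"

lemma subalgebra_\<Theta>_M: "\<theta> \<in> \<Theta> \<Longrightarrow> subalgebra \<theta> M"
  using prob_\<Theta>[of \<theta>] sets_eq_imp_space_eq[of \<theta> M] by (simp add: subalgebra_def)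

lemma subalgebra_\<Theta>: "\<theta> \<in> \<Theta> \<Longrightarrow> subalgebra \<theta> G"
  by (metis subalgebra_\<Theta>_M subalgebra_G subalgebra_def order_trans)

lemma subalgebra_\<Phi>: "\<phi> \<in> \<Phi> \<Longrightarrow> subalgebra \<phi> G"
  using witness sets_eq_imp_space_eq[of \<phi> G] unfolding hahn_witness_def subalgebra_def by blast

lemma prob_\<Phi>: "\<phi> \<in> \<Phi> \<Longrightarrow> prob_space \<phi>"
  using witness unfolding hahn_witness_def by blast

lemma space_M: "space M = space G"
  using subalgebra_G by (simp add: subalgebra_def)

lemma polar_\<Phi>_iff: "polar G \<Phi> N \<longleftrightarrow> polar G \<Theta> N"
  using witness unfolding hahn_witness_def by blast

lemma borel_measurable_\<Phi>: "(borel_measurable (joint_completion G \<Phi>) :: ('a \<Rightarrow> real) set) = borel_measurable J"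
  using witness unfolding hahn_witness_def by (elim conjE) (rule sym)

text \<open>The witness speaks of real measurable functions; indicators transfer this to sets.\<close>

lemma sets_\<Phi>: "sets (joint_completion G \<Phi>) = sets J"
proof -
  have iff: "A \<in> sets N \<longleftrightarrow> (indicator A :: 'a \<Rightarrow> real) \<in> borel_measurable N"
    if "space N = space G" "A \<subseteq> space G" for A N
  proof -
    have "A \<inter> space N = A" using that by blast
    then show ?thesis by (metis borel_measurable_indicator_iff)
  qed
  have "A \<in> sets (joint_completion G \<Phi>) \<longleftrightarrow> A \<in> sets J" if "A \<subseteq> space G" for A
    unfolding iff[OF space_joint_completion that] borel_measurable_\<Phi> ..
  then show ?thesis
    using sets.sets_into_space[of _ "joint_completion G \<Phi>"] sets.sets_into_space[of _ J]
    unfolding space_joint_completion by blast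
qed

lemma S_sets: "\<phi> \<in> \<Phi> \<Longrightarrow> S \<phi> \<in> sets J"
  using witness unfolding hahn_witness_def by blast

lemma emeasure_S: "\<phi> \<in> \<Phi> \<Longrightarrow> emeasure (\<Phi>_ext \<phi>) (S \<phi>) = 1"
  using witness unfolding hahn_witness_def by blast

lemma disjoint_S: "\<phi> \<in> \<Phi> \<Longrightarrow> \<phi>' \<in> \<Phi> \<Longrightarrow> \<phi> \<noteq> \<phi>' \<Longrightarrow> S \<phi> \<inter> S \<phi>' = {}"
  using witness unfolding hahn_witness_def disjoint_family_on_def by blast

sublocale M\<Theta>: subalgebra_family M \<Theta> by unfold_locales (rule subalgebra_\<Theta>_M)
sublocale G\<Theta>: subalgebra_family G \<Theta> by unfold_locales (rule subalgebra_\<Theta>)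
sublocale G\<Phi>: subalgebra_family G \<Phi> by unfold_locales (rule subalgebra_\<Phi>)

lemma sets_\<Phi>_ext: "\<phi> \<in> \<Phi> \<Longrightarrow> sets (\<Phi>_ext \<phi>) = sets J"
  using G\<Phi>.sets_extension sets_\<Phi> by simp

lemma prob_space_\<Theta>_ext: "\<theta> \<in> \<Theta> \<Longrightarrow> prob_space (\<Theta>_ext \<theta>)"
  using G\<Theta>.prob_space_extension prob_\<Theta> by auto

lemma prob_space_\<Phi>_ext: "\<phi> \<in> \<Phi> \<Longrightarrow> prob_space (\<Phi>_ext \<phi>)"
  using G\<Phi>.prob_space_extension prob_\<Phi> by auto

lemma AE_S: "\<phi> \<in> \<Phi> \<Longrightarrow> AE \<omega> in \<Phi>_ext \<phi>. \<omega> \<in> S \<phi>"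
  using prob_space.AE_prob_1[OF prob_space_\<Phi>_ext, of \<phi> "S \<phi>"] emeasure_S[of \<phi>]
  by (simp add: measure_def)

text \<open>By disjointness, a measurable subset of \<open>S \<phi>\<close> is null for all \<open>\<phi>' \<noteq> \<phi>\<close>.\<close>

lemma polar_if_null_on_S:
  assumes \<phi>: "\<phi> \<in> \<Phi>" and N: "N \<in> null_sets (\<Phi>_ext \<phi>)" "N \<subseteq> S \<phi>"
  shows "polar G \<Theta> N"
proof -
  have NJ: "N \<in> sets J" using N(1) sets_\<Phi>_ext[OF \<phi>] by auto
  have "N \<in> null_sets (\<Phi>_ext \<phi>')" if \<phi>': "\<phi>' \<in> \<Phi>" for \<phi>'
  proof (cases "\<phi>' = \<phi>")
    case False
    have "AE \<omega> in \<Phi>_ext \<phi>'. \<omega> \<notin> N"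
      using AE_S[OF \<phi>'] by eventually_elim (use disjoint_S[OF \<phi> \<phi>'] False N(2) in auto)
    then show ?thesis using NJ sets_\<Phi>_ext[OF \<phi>'] by (simp add: AE_iff_null_sets)
  qed (use N in simp)
  then have "polar G \<Phi> N"
    using NJ sets_\<Phi> by (simp add: G\<Phi>.polar_iff_null_sets)
  then show ?thesis by (simp add: polar_\<Phi>_iff)
qed

lemma null_set_if_polar: "\<theta> \<in> \<Theta> \<Longrightarrow> polar G \<Theta> N \<Longrightarrow> N \<in> null_sets (\<Theta>_ext \<theta>)"
  by (simp add: G\<Theta>.polar_iff_null_sets)

text \<open>Absolute continuity of \<open>\<theta>\<close> with respect to \<open>\<phi>\<close> on \<open>S \<phi>\<close>.\<close>

lemma null_set_if_null_on_S:
  "\<phi> \<in> \<Phi> \<Longrightarrow> \<theta> \<in> \<Theta> \<Longrightarrow> N \<in> null_sets (\<Phi>_ext \<phi>) \<Longrightarrow> N \<subseteq> S \<phi> \<Longrightarrow> N \<in> null_sets (\<Theta>_ext \<theta>)"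
  by (rule null_set_if_polar[OF _ polar_if_null_on_S])

text \<open>The second claim is the absolute continuity of \<open>\<phi>\<close> with respect to \<open>\<theta>\<close> on
  \<open>support_part \<theta> \<phi>\<close>.\<close>

lemma
  assumes \<phi>: "\<phi> \<in> \<Phi>" and \<theta>: "\<theta> \<in> \<Theta>"
  shows derivative_measurable: "derivative \<theta> \<phi> \<in> borel_measurable J"
    and null_set_if_null_on_support_part: "\<And>N. N \<in> null_sets (\<Theta>_ext \<theta>) \<Longrightarrow>
      N \<subseteq> support_part \<theta> \<phi> \<Longrightarrow> N \<in> null_sets (\<Phi>_ext \<phi>)"
proof -
  interpret prob_space "\<Phi>_ext \<phi>" by (rule prob_space_\<Phi>_ext[OF \<phi>])
  let ?P = "restrict_space (\<Phi>_ext \<phi>) (S \<phi>)" and ?T = "restrict_space (\<Theta>_ext \<theta>) (S \<phi>)"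
  let ?f = "RN_deriv ?P ?T"
  note SP = S_sets[OF \<phi>, folded sets_\<Phi>_ext[OF \<phi>]]
  note ST = S_sets[OF \<phi>, folded G\<Theta>.sets_extension[OF \<theta>]]
  interpret P: finite_measure ?P
    using finite_measure_axioms SP by (rule finite_measure_restrict_space)
  have sets_eq: "sets ?T = sets ?P"
    by (simp add: sets_restrict_space sets_\<Phi>_ext[OF \<phi>] G\<Theta>.sets_extension[OF \<theta>])
  have "absolutely_continuous ?P ?T"
    unfolding absolutely_continuous_def
    using null_set_if_null_on_S[OF \<phi> \<theta>]
    by (auto simp: null_sets_restrict_space[OF SP] null_sets_restrict_space[OF ST])
  from P.density_RN_deriv[OF this sets_eq]
  have dens: "density ?P ?f = ?T" .
  have f: "?f \<in> borel_measurable ?P" by simp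
  have d: "derivative \<theta> \<phi> \<omega> = enn2ereal (?f \<omega>) * indicator (S \<phi>) \<omega>" for \<omega>
    by (simp add: support_density_def)
  have "(\<lambda>\<omega>. enn2ereal (?f \<omega>)) \<in> borel_measurable ?P" using f by measurable
  then show "derivative \<theta> \<phi> \<in> borel_measurable J"
    using borel_measurable_restrict_space_iff_ereal[of "S \<phi>" "\<Phi>_ext \<phi>"] SP
    unfolding d[abs_def] measurable_cong_sets[OF sets_\<Phi>_ext[OF \<phi>, symmetric] refl] by simp
  fix N assume N: "N \<in> null_sets (\<Theta>_ext \<theta>)" "N \<subseteq> support_part \<theta> \<phi>"
  have pos: "\<omega> \<in> S \<phi> \<and> ?f \<omega> > 0" if "\<omega> \<in> N" for \<omega>
  proof -
    have "0 < derivative \<theta> \<phi> \<omega>" using that N(2) by (auto simp: support_part_def)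
    then show ?thesis
      unfolding d by (cases "\<omega> \<in> S \<phi>") (simp_all add: less_ennreal.rep_eq zero_ennreal.rep_eq)
  qed
  then have NS: "N \<subseteq> S \<phi>" by blast
  have NP: "N \<in> sets ?P"
  proof -
    have "N \<in> sets (\<Phi>_ext \<phi>)"
      using N(1) G\<Theta>.sets_extension[OF \<theta>] sets_\<Phi>_ext[OF \<phi>] by auto
    then show ?thesis using SP NS by (simp add: sets_restrict_space_iff)
  qed
  have "N \<in> null_sets ?T" unfolding null_sets_restrict_space[OF ST] using N(1) NS by blast
  then have "AE \<omega> in ?P. \<omega> \<in> N \<longrightarrow> ?f \<omega> = 0"
    using null_sets_density_iff[OF f, of N, unfolded dens] by blast
  then have "AE \<omega> in ?P. \<omega> \<notin> N"
  proof eventually_elim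
    case (elim \<omega>)
    then show ?case using pos[of \<omega>] by auto
  qed
  then have "N \<in> null_sets ?P" using NP by (simp add: AE_iff_null_sets)
  then show "N \<in> null_sets (\<Phi>_ext \<phi>)" by (simp add: null_sets_restrict_space[OF SP])
qed

lemma support_part_subset_S: "support_part \<theta> \<phi> \<subseteq> S \<phi>"
  by (auto simp: support_part_def support_density_def indicator_def split: if_splits)

lemma support_part_sets: "\<phi> \<in> \<Phi> \<Longrightarrow> \<theta> \<in> \<Theta> \<Longrightarrow> support_part \<theta> \<phi> \<in> sets J"
  using measurable_sets[OF derivative_measurable, of \<phi> \<theta> "{0<..}"]
  by (simp add: support_part_def vimage_def Int_def conj_commute)

lemma quasi_surelyI:
  assumes "polar G \<Theta> N" and "\<And>\<omega>. \<omega> \<in> space G \<Longrightarrow> \<omega> \<notin> N \<Longrightarrow> P \<omega>"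
  shows "quasi_surely M \<Theta> P"
  using polar_mono_algebra[OF subalgebra_G subalgebra_\<Theta>_M assms(1)] assms(2)
  by (auto simp: quasi_surely_def space_M)

text \<open>A carrier outside a countable essential subcover is disjoint from it, hence null.\<close>

lemma countable_not_null_S:
  assumes \<theta>: "\<theta> \<in> \<Theta>"
  shows "countable {\<phi>\<in>\<Phi>. S \<phi> \<notin> null_sets (\<Theta>_ext \<theta>)}"
proof (cases "\<Phi> = {}")
  case False
  interpret prob_space "\<Theta>_ext \<theta>" by (rule prob_space_\<Theta>_ext[OF \<theta>])
  obtain \<sigma> :: "nat \<Rightarrow> 'a measure" where \<sigma>: "range \<sigma> \<subseteq> \<Phi>"
    "\<And>\<phi>. \<phi> \<in> \<Phi> \<Longrightarrow> S \<phi> - (\<Union>n. S (\<sigma> n)) \<in> null_sets (\<Theta>_ext \<theta>)"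
    using ex_countable_essential_cover[of \<Phi> S, OF False] S_sets G\<Theta>.sets_extension[OF \<theta>] by metis
  have "\<phi> \<in> range \<sigma>" if "\<phi> \<in> \<Phi>" "S \<phi> \<notin> null_sets (\<Theta>_ext \<theta>)" for \<phi>
  proof (rule ccontr)
    assume "\<phi> \<notin> range \<sigma>"
    then have "S \<phi> \<inter> S (\<sigma> n) = {}" for n
      using disjoint_S[OF that(1)] \<sigma>(1) by (metis rangeI subsetD)
    then have "S \<phi> - (\<Union>n. S (\<sigma> n)) = S \<phi>" by auto
    with \<sigma>(2)[OF that(1)] that(2) show False by simp
  qed
  then have "{\<phi>\<in>\<Phi>. S \<phi> \<notin> null_sets (\<Theta>_ext \<theta>)} \<subseteq> range \<sigma>" by auto
  then show ?thesis by (rule countable_subset) simp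
qed simp

section \<open>Supports\<close>

text \<open>The support \<open>T\<close> of \<open>\<psi>\<close> contains each \<open>support_part \<psi> \<phi>\<close> quasi-surely, hence almost surely
  under every \<open>\<theta>\<close>.\<close>

lemma AE_support_part_subset_support:
  assumes T: "is_support M G \<Theta> \<Phi> S \<psi> T" and \<phi>: "\<phi> \<in> \<Phi>" and \<theta>: "\<theta> \<in> \<Theta>"
  shows "AE \<omega> in \<theta>. \<omega> \<in> support_part \<psi> \<phi> \<longrightarrow> \<omega> \<in> T"
proof -
  obtain Z where Z: "is_ess_sup M G \<Theta> (derivative \<psi> ` \<Phi>) Z" "T = {\<omega>\<in>space M. Z \<omega> > 0}"
    using T by (auto simp: is_support_def)
  then have "quasi_surely M \<Theta> (\<lambda>\<omega>. derivative \<psi> \<phi> \<omega> \<le> Z \<omega>)"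
    using \<phi> by (auto simp: is_ess_sup_def)
  from M\<Theta>.AE_if_quasi_surely[OF \<theta> this] show ?thesis
    by eventually_elim (auto simp: support_part_def Z(2) space_M)
qed

text \<open>Both halves of the notion of a support enter here: the minimality of the essential supremum
  yields the countable cover of \<open>T\<close>, and \<open>T\<close> has full measure.\<close>

lemma AE_in_charged_support_part:
  assumes T: "is_support M G \<Theta> \<Phi> S \<theta> T" and \<theta>: "\<theta> \<in> \<Theta>"
  shows "AE \<omega> in \<theta>. \<exists>\<phi>\<in>{\<phi>\<in>\<Phi>. S \<phi> \<notin> null_sets (\<Theta>_ext \<theta>)}. \<omega> \<in> support_part \<theta> \<phi>"
proof -
  define C where "C = {\<phi>\<in>\<Phi>. S \<phi> \<notin> null_sets (\<Theta>_ext \<theta>)}"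
  have C: "countable C" unfolding C_def by (rule countable_not_null_S[OF \<theta>])
  obtain Z where Z: "is_ess_sup M G \<Theta> (derivative \<theta> ` \<Phi>) Z" "T = {\<omega>\<in>space M. Z \<omega> > 0}"
    using T by (auto simp: is_support_def)
  \<comment> \<open>The derivatives are nonnegative, but their supremum over an empty \<open>C\<close> is \<open>-\<infinity>\<close>.\<close>
  define Y where "Y \<omega> = max 0 (SUP \<phi>\<in>C. derivative \<theta> \<phi> \<omega>)" for \<omega>
  have [measurable]: "(\<lambda>\<omega>. SUP \<phi>\<in>C. derivative \<theta> \<phi> \<omega>) \<in> borel_measurable J"
    by (rule borel_measurable_SUP[OF C]) (auto simp: C_def intro: derivative_measurable \<theta>)
  have Y: "Y \<in> borel_measurable J" unfolding Y_def by measurable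
  have "quasi_surely M \<Theta> (\<lambda>\<omega>. derivative \<theta> \<phi> \<omega> \<le> Y \<omega>)" if \<phi>: "\<phi> \<in> \<Phi>" for \<phi>
  proof (cases "\<phi> \<in> C")
    case True
    then have "derivative \<theta> \<phi> \<omega> \<le> Y \<omega>" for \<omega>
      unfolding Y_def by (intro max.coboundedI2 SUP_upper)
    then show ?thesis
      by (intro quasi_surelyI[of "{}"]) (auto simp: polar_def)
  next
    case False
    then have "S \<phi> \<in> null_sets (\<Theta>_ext \<theta>)" using \<phi> by (simp add: C_def)
    then have "support_part \<theta> \<phi> \<in> null_sets (\<Theta>_ext \<theta>)"
      using support_part_subset_S support_part_sets[OF \<phi> \<theta>] G\<Theta>.sets_extension[OF \<theta>]
      by (blast intro: null_sets_subset)
    then have "polar G \<Theta> (support_part \<theta> \<phi>)"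
      using null_set_if_null_on_support_part[OF \<phi> \<theta>] polar_if_null_on_S[OF \<phi>] support_part_subset_S
      by blast
    then show ?thesis
      by (rule quasi_surelyI) (auto simp: support_part_def Y_def max.coboundedI1)
  qed
  then have "quasi_surely M \<Theta> (\<lambda>\<omega>. Z \<omega> \<le> Y \<omega>)"
    using Z(1) Y by (auto simp: is_ess_sup_def)
  from M\<Theta>.AE_if_quasi_surely[OF \<theta> this]
  have 1: "AE \<omega> in \<theta>. Z \<omega> \<le> Y \<omega>" .
  have Zm: "Z \<in> borel_measurable J" using Z(1) by (simp add: is_ess_sup_def)
  have TJ: "T \<in> sets J"
    using measurable_sets[OF Zm, of "{0<..}"]
    by (simp add: Z(2) space_M vimage_def Int_def conj_commute)
  interpret prob_space "\<Theta>_ext \<theta>" by (rule prob_space_\<Theta>_ext[OF \<theta>])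
  have "AE \<omega> in \<Theta>_ext \<theta>. \<omega> \<in> T"
    using T TJ G\<Theta>.sets_extension[OF \<theta>] by (intro AE_prob_1) (auto simp: is_support_def measure_def)
  from G\<Theta>.AE_if_AE_extension[OF \<theta> this] 1
  have "AE \<omega> in \<theta>. \<exists>\<phi>\<in>C. \<omega> \<in> support_part \<theta> \<phi>"
  proof eventually_elim
    case (elim \<omega>)
    then have "0 < (SUP \<phi>\<in>C. derivative \<theta> \<phi> \<omega>)" "\<omega> \<in> space G"
      by (auto simp: Z(2) Y_def space_M less_max_iff_disj dest: less_le_trans)
    then show ?case by (auto simp: less_SUP_iff support_part_def)
  qed
  then show ?thesis by (simp add: C_def)
qed

end

section \<open>Aggregation\<close>

theorem theorem4:
  fixes M G :: "'a measure"
    and \<Theta> \<Phi> :: "'a measure set"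
    and S T :: "'a measure \<Rightarrow> 'a set"
    and X :: "'a measure \<Rightarrow> 'a \<Rightarrow> real"
  assumes "subalgebra M G"
    and "\<And>\<theta>. \<theta> \<in> \<Theta> \<Longrightarrow> prob_space \<theta> \<and> sets \<theta> = sets M"
    and "hahn_witness G \<Theta> \<Phi> S"
    and "\<And>\<theta>. \<theta> \<in> \<Theta> \<Longrightarrow> is_support M G \<Theta> \<Phi> S \<theta> (T \<theta>)"
    and "\<And>\<theta>. \<theta> \<in> \<Theta> \<Longrightarrow> X \<theta> \<in> borel_measurable (completion_on G \<theta>)"
    and "\<And>\<theta> \<psi>. \<theta> \<in> \<Theta> \<Longrightarrow> \<psi> \<in> \<Theta> \<Longrightarrow>
           AE \<omega> in \<theta>. \<omega> \<in> T \<theta> \<inter> T \<psi> \<longrightarrow> X \<theta> \<omega> = X \<psi> \<omega>"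
  shows "\<exists>Y\<in>borel_measurable (joint_completion G \<Theta>). \<forall>\<theta>\<in>\<Theta>. AE \<omega> in \<theta>. Y \<omega> = X \<theta> \<omega>"
proof -
  interpret hahn_setting M G \<Theta> \<Phi> S by unfold_locales (use assms in auto)
  have "\<exists>g\<in>borel_measurable G. AE \<omega> in restr_to_subalg \<theta> G. X \<theta> \<omega> = g \<omega>" if \<theta>: "\<theta> \<in> \<Theta>" for \<theta>
    using completion_ex_borel_measurable_real[OF assms(5)[OF \<theta>, unfolded completion_on_def]]
      measurable_in_subalg'[OF subalgebra_\<Theta>[OF \<theta>]]
    by (auto simp: measurable_cong_sets[OF sets_restr_to_subalg[OF subalgebra_\<Theta>[OF \<theta>]] refl])
  then obtain g where g: "\<And>\<theta>. \<theta> \<in> \<Theta> \<Longrightarrow> g \<theta> \<in> borel_measurable G"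
      and Xg: "\<And>\<theta>. \<theta> \<in> \<Theta> \<Longrightarrow> AE \<omega> in restr_to_subalg \<theta> G. X \<theta> \<omega> = g \<theta> \<omega>"
    by metis
  have XgT: "AE \<omega> in \<theta>. X \<theta> \<omega> = g \<theta> \<omega>" if \<theta>: "\<theta> \<in> \<Theta>" for \<theta>
    by (rule AE_restr_to_subalg[OF subalgebra_\<Theta>[OF \<theta>] Xg[OF \<theta>]])
  have gJ: "g \<theta> \<in> borel_measurable J" if \<theta>: "\<theta> \<in> \<Theta>" for \<theta>
    using g[OF \<theta>] G\<Theta>.sets_subset_joint
    by (auto intro!: measurable_from_subalg[of J G] simp: subalgebra_def)
  have agree: "AE \<omega> in \<Phi>_ext \<phi>.
      \<omega> \<in> support_part \<theta> \<phi> \<inter> support_part \<psi> \<phi> \<longrightarrow> g \<theta> \<omega> = g \<psi> \<omega>"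
    if \<theta>: "\<theta> \<in> \<Theta>" and \<psi>: "\<psi> \<in> \<Theta>" and \<phi>: "\<phi> \<in> \<Phi>" for \<theta> \<psi> \<phi>
  proof -
    let ?D = "support_part \<theta> \<phi>" and ?E = "support_part \<psi> \<phi>"
    note [measurable] = gJ[OF \<theta>] gJ[OF \<psi>]
    note D = support_part_sets[OF \<phi> \<theta>] and E = support_part_sets[OF \<phi> \<psi>]
    define B where "B = {\<omega>\<in>space J. g \<theta> \<omega> \<noteq> g \<psi> \<omega>} \<inter> (?D \<inter> ?E)"
    have B: "B \<in> sets J" unfolding B_def by (intro sets.Int D E) measurable
    obtain N where N: "N \<in> null_sets (restr_to_subalg \<psi> G)"
      "{\<omega>\<in>space (restr_to_subalg \<psi> G). X \<psi> \<omega> \<noteq> g \<psi> \<omega>} \<subseteq> N"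
      using Xg[OF \<psi>] unfolding eventually_ae_filter by auto
    have N': "N \<in> null_sets \<psi> \<inter> sets G"
      using N(1) by (simp add: null_sets_restr_to_subalg[OF subalgebra_\<Theta>[OF \<psi>]])
    then have NJ: "N \<in> sets J"
      using G\<Theta>.sets_subset_joint by auto
    \<comment> \<open>\<open>N\<close> need not be \<open>\<theta>\<close>-null, but \<open>N \<inter> ?E\<close> is: its nullity passes from \<open>\<psi>\<close> to \<open>\<phi>\<close> to \<open>\<theta>\<close>.\<close>
    have "N \<inter> ?E \<in> null_sets (\<Theta>_ext \<psi>)"
      using N' NJ E by (auto simp: G\<Theta>.null_sets_extension_iff[OF \<psi>])
    then have "N \<inter> ?E \<in> null_sets (\<Phi>_ext \<phi>)"
      by (rule null_set_if_null_on_support_part[OF \<phi> \<psi>]) auto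
    then have "N \<inter> ?E \<in> null_sets (\<Theta>_ext \<theta>)"
      by (rule null_set_if_null_on_S[OF \<phi> \<theta>]) (use support_part_subset_S in auto)
    then have "AE \<omega> in \<theta>. \<omega> \<notin> N \<inter> ?E"
      by (intro G\<Theta>.AE_if_AE_extension[OF \<theta>] AE_not_in)
    with assms(6)[OF \<theta> \<psi>] XgT[OF \<theta>]
      AE_support_part_subset_support[OF assms(4)[OF \<theta>] \<phi> \<theta>]
      AE_support_part_subset_support[OF assms(4)[OF \<psi>] \<phi> \<theta>]
    have "AE \<omega> in \<theta>. \<omega> \<notin> B"
    proof eventually_elim
      case (elim \<omega>)
      then show ?case
        using N(2) subalgebra_\<Theta>[OF \<psi>] by (auto simp: B_def space_restr_to_subalg subalgebra_def)
    qed
    then have "B \<in> null_sets (\<Theta>_ext \<theta>)" by (rule G\<Theta>.null_sets_extensionI[OF \<theta> B])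
    then have "B \<in> null_sets (\<Phi>_ext \<phi>)"
      by (rule null_set_if_null_on_support_part[OF \<phi> \<theta>]) (auto simp: B_def)
    then show ?thesis
      by (rule AE_I') (auto simp: B_def G\<Phi>.space_extension[OF \<phi>])
  qed
  have "\<exists>y. y \<in> borel_measurable J \<and>
      (\<forall>\<theta>\<in>\<Theta>. AE \<omega> in \<Phi>_ext \<phi>. \<omega> \<in> support_part \<theta> \<phi> \<longrightarrow> y \<omega> = g \<theta> \<omega>)" if \<phi>: "\<phi> \<in> \<Phi>" for \<phi>
  proof -
    interpret prob_space "\<Phi>_ext \<phi>" by (rule prob_space_\<Phi>_ext[OF \<phi>])
    note cong = measurable_cong_sets[OF sets_\<Phi>_ext[OF \<phi>] refl]
    have "support_part \<theta> \<phi> \<in> events" "g \<theta> \<in> borel_measurable (\<Phi>_ext \<phi>)" if "\<theta> \<in> \<Theta>" for \<theta>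
      using support_part_sets[OF \<phi> that] gJ[OF that] unfolding sets_\<Phi>_ext[OF \<phi>] cong by blast+
    then have "\<exists>z\<in>borel_measurable (\<Phi>_ext \<phi>).
        \<forall>\<theta>\<in>\<Theta>. AE \<omega> in \<Phi>_ext \<phi>. \<omega> \<in> support_part \<theta> \<phi> \<longrightarrow> z \<omega> = g \<theta> \<omega>"
      using agree[OF _ _ \<phi>] by (rule ex_measurable_gluing)
    then show ?thesis unfolding cong Bex_def .
  qed
  then obtain y where y: "\<And>\<phi>. \<phi> \<in> \<Phi> \<Longrightarrow> y \<phi> \<in> borel_measurable J"
    and yg: "\<And>\<phi> \<theta>. \<phi> \<in> \<Phi> \<Longrightarrow> \<theta> \<in> \<Theta> \<Longrightarrow>
      AE \<omega> in \<Phi>_ext \<phi>. \<omega> \<in> support_part \<theta> \<phi> \<longrightarrow> y \<phi> \<omega> = g \<theta> \<omega>"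
    by metis
  define Y where "Y \<omega> = (if \<exists>\<phi>\<in>\<Phi>. \<omega> \<in> S \<phi> then y (THE \<phi>. \<phi> \<in> \<Phi> \<and> \<omega> \<in> S \<phi>) \<omega> else 0)" for \<omega>
  have Yy: "Y \<omega> = y \<phi> \<omega>" if "\<phi> \<in> \<Phi>" "\<omega> \<in> S \<phi>" for \<phi> \<omega>
  proof -
    have "(THE \<phi>. \<phi> \<in> \<Phi> \<and> \<omega> \<in> S \<phi>) = \<phi>" using that disjoint_S by (intro the_equality) auto
    then show ?thesis using that by (auto simp: Y_def)
  qed
  have "Y \<in> borel_measurable (joint_completion G \<Phi>)"
  proof (rule G\<Phi>.borel_measurable_jointI)
    fix \<phi> assume \<phi>: "\<phi> \<in> \<Phi>"
    note sub = G\<Phi>.subalgebra_joint[OF \<phi>]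
    have "y \<phi> \<in> borel_measurable (joint_completion G \<Phi>)" using y[OF \<phi>] borel_measurable_\<Phi> by simp
    then have y': "y \<phi> \<in> borel_measurable (completion_on G \<phi>)" by (rule measurable_from_subalg[OF sub])
    have "AE \<omega> in \<Phi>_ext \<phi>. y \<phi> \<omega> = Y \<omega>"
      using AE_S[OF \<phi>] by eventually_elim (simp add: Yy[OF \<phi>])
    then have "AE \<omega> in completion_on G \<phi>. y \<phi> \<omega> = Y \<omega>"
      unfolding extension_def by (rule AE_restr_to_subalg[OF sub])
    with y' show "Y \<in> borel_measurable (completion_on G \<phi>)"
      unfolding completion_on_def by (rule borel_measurable_completion_cong_AE)
  qed
  then have "Y \<in> borel_measurable J" using borel_measurable_\<Phi> by simp
  moreover have "AE \<omega> in \<theta>. Y \<omega> = X \<theta> \<omega>" if \<theta>: "\<theta> \<in> \<Theta>" for \<theta>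
  proof -
    let ?C = "{\<phi>\<in>\<Phi>. S \<phi> \<notin> null_sets (\<Theta>_ext \<theta>)}"
    have "AE \<omega> in \<theta>. \<omega> \<in> support_part \<theta> \<phi> \<longrightarrow> Y \<omega> = g \<theta> \<omega>" if \<phi>: "\<phi> \<in> \<Phi>" for \<phi>
    proof -
      note [measurable] = gJ[OF \<theta>] y[OF \<phi>]
      define B where "B = {\<omega>\<in>space J. y \<phi> \<omega> \<noteq> g \<theta> \<omega>} \<inter> support_part \<theta> \<phi>"
      have "B \<in> sets J" unfolding B_def by (intro sets.Int support_part_sets \<phi> \<theta>) measurable
      moreover have "AE \<omega> in \<Phi>_ext \<phi>. \<omega> \<notin> B"
        using yg[OF \<phi> \<theta>] by eventually_elim (auto simp: B_def)
      ultimately have "B \<in> null_sets (\<Phi>_ext \<phi>)"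
        using sets_\<Phi>_ext[OF \<phi>] by (simp add: AE_iff_null_sets)
      then have "B \<in> null_sets (\<Theta>_ext \<theta>)"
        by (rule null_set_if_null_on_S[OF \<phi> \<theta>]) (use support_part_subset_S in \<open>auto simp: B_def\<close>)
      then have "AE \<omega> in \<theta>. \<omega> \<notin> B"
        by (intro G\<Theta>.AE_if_AE_extension[OF \<theta>] AE_not_in)
      then show ?thesis
      proof eventually_elim
        case (elim \<omega>)
        then show ?case
          using support_part_subset_S[of \<theta> \<phi>] Yy[OF \<phi>, of \<omega>] by (auto simp: B_def support_part_def)
      qed
    qed
    then have "AE \<omega> in \<theta>. \<forall>\<phi>\<in>?C. \<omega> \<in> support_part \<theta> \<phi> \<longrightarrow> Y \<omega> = g \<theta> \<omega>"
      by (subst AE_ball_countable[OF countable_not_null_S[OF \<theta>]]) auto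
    with AE_in_charged_support_part[OF assms(4)[OF \<theta>] \<theta>] XgT[OF \<theta>] show ?thesis
      by eventually_elim auto
  qed
  ultimately show ?thesis by blast
qed

end
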